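(* Let $\{\mathbf{v}^k\}\subset\mathbb{R}^d$ be a sequence of nonnegative random vectors and $\{b^k\}$ be a sequence of nonnegative random scalars such that $\sum_{k=0}^\infty b^k<\infty$ almost surely and $$\mathbb{E}[\mathbf{v}^{k+1}\mid\mathcal{F}^k]\le V^k\mathbf{v}^k+b^k\mathbf{1},\quad\forall k\ge0\quad\text{almost surely},$$ where $\{V^k\}$ is a sequence of nonnegative matrices and $\mathcal{F}^k=\{\mathbf{v}^\ell,b^\ell;0\le\ell\le k\}$. Assume that there exist a vector $\pi>0$ and a deterministic scalar sequence $\{a^k\}$ satisfying $a^k\in(0,1)$, $\sum_{k=0}^\infty a^k=\infty$, and $\pi^TV^k\le(1-a^k)\pi^T$ for all $k\ge0$. Then $\lim_{k\to\infty}\mathbf{v}^k=0$ almost surely.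
   Context: Vector inequalities are entrywise; a nonnegative vector or matrix has nonnegative entries and $\pi>0$ means all entries of $\pi\in\mathbb{R}^d$ are positive. $\mathbf{1}\in\mathbb{R}^d$ is the all-ones vector and $V^k\in\mathbb{R}^{d\times d}$. $\mathbb{E}[\cdot\mid\mathcal{F}^k]$ is conditional expectation given the random variables listed in $\mathcal{F}^k$. *)

theory Defs
  imports "HOL-Probability.Probability"
begin

definition history ::
  "'a measure \<Rightarrow> (nat \<Rightarrow> 'a \<Rightarrow> real ^ 'd) \<Rightarrow> (nat \<Rightarrow> 'a \<Rightarrow> real) \<Rightarrow> nat \<Rightarrow> 'a measure"
where
  "history M v b k = sigma (space M)
     ({v l -` A \<inter> space M | l A. l \<le> k \<and> A \<in> sets borel} \<union>
      {b l -` B \<inter> space M | l B. l \<le> k \<and> B \<in> sets borel})"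

(* nn_cond_exp returns the constant 0 unless the second measure is a subalgebra of the first. *)
lemma subalgebra_history:
  fixes v :: "nat \<Rightarrow> 'a \<Rightarrow> real ^ 'd"
  assumes "\<And>k. v k \<in> borel_measurable M" and "\<And>k. b k \<in> borel_measurable M"
  shows "subalgebra M (history M v b k)"
proof -
  let ?G = "{v l -` A \<inter> space M | l A. l \<le> k \<and> A \<in> sets borel} \<union>
      {b l -` B \<inter> space M | l B. l \<le> k \<and> B \<in> sets borel}"
  have "?G \<subseteq> sets M"
    using assms by (auto intro: measurable_sets)
  moreover have "?G \<subseteq> Pow (space M)" by auto
  ultimately show ?thesis
    unfolding subalgebra_def history_def
    by (simp add: space_measure_of sets_measure_of sets.sigma_sets_subset)
qed

end

(* The scalar process W k = \<pi> \<bullet> v k satisfies E[W (k+1) | F k] \<le> (1 - a k) W k + \<beta> k.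
   Restricting to the predictable events on which W 0 and the partial sums of \<beta> stay below a
   level N makes the expectations of W 0 and of the sum of \<beta> finite. Divergence of the sum of
   the a k then forces the expectation of W n to be arbitrarily small for arbitrarily large n,
   and Doob's maximal inequality started at such n bounds the probability of a late excursion
   of W above any fixed level; no martingale convergence theorem is needed. Letting N grow
   exhausts the space. *)
theory Submission
  imports Defs
begin

section \<open>Tails of convergent nonnegative series\<close>

text \<open>A finite total forces every term to be finite, so the series is the image of a summable
  real series, and the real tail estimate carries over.\<close>

lemma ennreal_suminf_exist_split:
  fixes f :: "nat \<Rightarrow> ennreal"
  assumes "(\<Sum>k. f k) < \<infinity>" and "0 < \<delta>"
  shows "\<exists>m. \<forall>n\<ge>m. (\<Sum>k. f (k + n)) < ennreal \<delta>"
proof -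
  have "f k < \<infinity>" for k
    using ennreal_suminf_lessD[of f \<infinity> k] assms(1) by simp
  then have f: "f k = ennreal (enn2real (f k))" for k
    by simp
  have "(\<Sum>k. ennreal (enn2real (f k))) \<noteq> top"
    using assms(1) by (simp flip: f)
  then have sm: "summable (\<lambda>k. enn2real (f k))"
    by (intro summable_suminf_not_top) auto
  then obtain m where m: "\<And>n. m \<le> n \<Longrightarrow> norm (\<Sum>k. enn2real (f (k + n))) < \<delta>"
    using suminf_exist_split[OF \<open>0 < \<delta>\<close>] by blast
  have "(\<Sum>k. f (k + n)) < ennreal \<delta>" if "m \<le> n" for n
  proof -
    have sn: "summable (\<lambda>k. enn2real (f (k + n)))"
      using sm by (rule summable_ignore_initial_segment)
    have "(\<Sum>k. f (k + n)) = (\<Sum>k. ennreal (enn2real (f (k + n))))"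
      by (simp flip: f)
    also have "\<dots> = ennreal (\<Sum>k. enn2real (f (k + n)))"
      using sn by (intro suminf_ennreal2) auto
    also have "\<dots> < ennreal \<delta>"
      using m[OF that] sn by (intro ennreal_lessI \<open>0 < \<delta>\<close>) auto
    finally show ?thesis .
  qed
  then show ?thesis by blast
qed

section \<open>Almost supermartingales with values in \<open>ennreal\<close>\<close>

text \<open>The assumption \<open>drift\<close> is the integrated form of E[W (k+1) | F k] \<le> (1
  - a k) W k + \<beta> k. In this form it restricts at once to events of \<open>F k\<close>, which
  both the maximal inequality and the localization exploit. Values in \<open>ennreal\<close> keep
  all expectations meaningful, even infinite ones.\<close>

locale almost_supermartingale =
  fixes M :: "'a measure" and F :: "nat \<Rightarrow> 'a measure"
    and W \<beta> :: "nat \<Rightarrow> 'a \<Rightarrow> ennreal" and a :: "nat \<Rightarrow> real"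
  assumes subalg: "subalgebra M (F k)"
    and filtration: "k \<le> l \<Longrightarrow> sets (F k) \<subseteq> sets (F l)"
    and W_adapted: "W k \<in> borel_measurable (F k)"
    and \<beta>_adapted: "\<beta> k \<in> borel_measurable (F k)"
    and a_bounds: "0 \<le> a k" "a k \<le> 1"
    and drift: "A \<in> sets (F k) \<Longrightarrow>
      (\<integral>\<^sup>+x\<in>A. W (Suc k) x \<partial>M) \<le> (\<integral>\<^sup>+x\<in>A. (ennreal (1 - a k) * W k x + \<beta> k x) \<partial>M)"
begin

lemma space_F [simp]: "space (F k) = space M"
  using subalg[of k] by (simp add: subalgebra_def)

lemma adapted_mono: "k \<le> l \<Longrightarrow> f \<in> borel_measurable (F k) \<Longrightarrow> f \<in> borel_measurable (F l)"
  using filtration[of k l] by (auto simp: measurable_def)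

lemma sets_F_M: "A \<in> sets (F k) \<Longrightarrow> A \<in> sets M"
  using subalg[of k] by (auto simp: subalgebra_def)

lemma W_measurable [measurable]: "W k \<in> borel_measurable M"
  using measurable_from_subalg[OF subalg W_adapted] .

lemma \<beta>_measurable [measurable]: "\<beta> k \<in> borel_measurable M"
  using measurable_from_subalg[OF subalg \<beta>_adapted] .

text \<open>Only times \<open>j < m\<close>, hence \<open>j \<le> k\<close>, enter the event. Its
  main use is \<open>m = Suc k\<close>: having stayed below \<open>c\<close> up to and including
  time \<open>k\<close> is decided at time \<open>k\<close>, so \<open>drift\<close> applies on that
  event.\<close>

lemma sets_below: "{x \<in> space M. \<forall>j\<in>{n..<m}. W j x < c} \<in> sets (F k)" if "m \<le> Suc k"
proof -
  have [simp]: "{x \<in> space M. W j x < c} \<in> sets (F k)" if "j \<in> {n..<m}" for j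
    using that \<open>m \<le> Suc k\<close> borel_measurable_less[OF adapted_mono[OF _ W_adapted], of j k "\<lambda>_. c"]
    by auto
  have "{x \<in> space (F k). \<forall>j\<in>{n..<m}. W j x < c} \<in> sets (F k)"
    by (intro sets.sets_Collect_finite_All) auto
  then show ?thesis by simp
qed

section \<open>Doob's maximal inequality\<close>

text \<open>The left side bounds from below the expectation of the process stopped on first reaching
  \<open>c\<close>: stopped paths are charged \<open>c\<close>, surviving paths their current value.
  One time step raises it by at most the expectation of \<beta>.\<close>

lemma maximal_step:
  fixes c :: ennreal
  defines "B \<equiv> \<lambda>n m. {x \<in> space M. \<forall>j\<in>{n..<m}. W j x < c}"
  assumes "n \<le> m"
  shows "c * emeasure M (space M - B n m) + (\<integral>\<^sup>+x\<in>B n m. W m x \<partial>M)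
    \<le> (\<integral>\<^sup>+x. W n x \<partial>M) + (\<Sum>j\<in>{n..<m}. \<integral>\<^sup>+x. \<beta> j x \<partial>M)"
  using \<open>n \<le> m\<close>
proof (induction m rule: dec_induct)
  case base
  show ?case by (auto simp: B_def intro!: nn_integral_mono split: split_indicator)
next
  case (step m)
  \<comment> \<open>\<open>?H\<close> is the event that the first time from \<open>n\<close> on with
    value at least \<open>c\<close> is exactly \<open>m\<close>. Splitting it off leaves
    \<open>B n (Suc m)\<close>, an event of \<open>F m\<close>.\<close>
  let ?H = "B n m - B n (Suc m)"
  have BF: "B n (Suc m) \<in> sets (F m)"
    unfolding B_def by (rule sets_below) simp
  have [measurable]: "B n m \<in> sets M" for m
    unfolding B_def by (rule sets_F_M[OF sets_below[of m m]]) simp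
  have H: "c \<le> W m x" if "x \<in> ?H" for x
    using that by (force simp: B_def less_Suc_eq not_less[symmetric])
  have sub: "B n (Suc m) \<subseteq> B n m" "B n m \<subseteq> space M"
    by (auto simp: B_def)
  have "c * emeasure M ?H = (\<integral>\<^sup>+x. c * indicator ?H x \<partial>M)"
    by (simp add: nn_integral_cmult_indicator)
  also have "\<dots> \<le> (\<integral>\<^sup>+x\<in>?H. W m x \<partial>M)"
    using H by (intro nn_integral_mono) (auto split: split_indicator)
  finally have 1: "c * emeasure M ?H \<le> (\<integral>\<^sup>+x\<in>?H. W m x \<partial>M)" .
  have "(\<integral>\<^sup>+x\<in>B n (Suc m). W (Suc m) x \<partial>M)
      \<le> (\<integral>\<^sup>+x\<in>B n (Suc m). (ennreal (1 - a m) * W m x + \<beta> m x) \<partial>M)"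
    by (rule drift[OF BF])
  \<comment> \<open>Here the contraction is given up (\<open>1 - a m \<le> 1\<close>) and \<beta> is
    integrated over the whole space; the gain from \<open>a\<close> is exploited separately, in the
    expectation bounds.\<close>
  also have "\<dots> \<le> (\<integral>\<^sup>+x. W m x * indicator (B n (Suc m)) x + \<beta> m x \<partial>M)"
  proof (intro nn_integral_mono)
    fix x
    have "ennreal (1 - a m) * W m x \<le> 1 * W m x"
      using a_bounds[of m] by (intro mult_right_mono) (auto simp: ennreal_le_1)
    then show "(ennreal (1 - a m) * W m x + \<beta> m x) * indicator (B n (Suc m)) x
        \<le> W m x * indicator (B n (Suc m)) x + \<beta> m x"
      by (auto split: split_indicator intro: add_right_mono)
  qed
  also have "\<dots> = (\<integral>\<^sup>+x\<in>B n (Suc m). W m x \<partial>M) + (\<integral>\<^sup>+x. \<beta> m x \<partial>M)"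
    by (rule nn_integral_add) auto
  finally have 2: "(\<integral>\<^sup>+x\<in>B n (Suc m). W (Suc m) x \<partial>M)
      \<le> (\<integral>\<^sup>+x\<in>B n (Suc m). W m x \<partial>M) + (\<integral>\<^sup>+x. \<beta> m x \<partial>M)" .
  have "emeasure M (space M - B n (Suc m)) = emeasure M ((space M - B n m) \<union> ?H)"
    using sub by (intro arg_cong[where f="emeasure M"]) auto
  also have "\<dots> = emeasure M (space M - B n m) + emeasure M ?H"
    by (intro plus_emeasure[symmetric]) auto
  finally have 3: "emeasure M (space M - B n (Suc m))
      = emeasure M (space M - B n m) + emeasure M ?H" .
  have "(\<integral>\<^sup>+x\<in>B n m. W m x \<partial>M)
      = (\<integral>\<^sup>+x. W m x * indicator ?H x + W m x * indicator (B n (Suc m)) x \<partial>M)"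
    using sub by (intro nn_integral_cong) (auto split: split_indicator)
  also have "\<dots> = (\<integral>\<^sup>+x\<in>?H. W m x \<partial>M) + (\<integral>\<^sup>+x\<in>B n (Suc m). W m x \<partial>M)"
    by (rule nn_integral_add) auto
  finally have 4: "(\<integral>\<^sup>+x\<in>B n m. W m x \<partial>M)
      = (\<integral>\<^sup>+x\<in>?H. W m x \<partial>M) + (\<integral>\<^sup>+x\<in>B n (Suc m). W m x \<partial>M)" .
  have "c * emeasure M (space M - B n (Suc m)) + (\<integral>\<^sup>+x\<in>B n (Suc m). W (Suc m) x \<partial>M)
      \<le> c * emeasure M (space M - B n m) + (\<integral>\<^sup>+x\<in>?H. W m x \<partial>M)
        + ((\<integral>\<^sup>+x\<in>B n (Suc m). W m x \<partial>M) + (\<integral>\<^sup>+x. \<beta> m x \<partial>M))"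
    unfolding 3 distrib_left by (intro add_mono 1 2 order_refl)
  also have "\<dots> = c * emeasure M (space M - B n m) + (\<integral>\<^sup>+x\<in>B n m. W m x \<partial>M) + (\<integral>\<^sup>+x. \<beta> m x \<partial>M)"
    unfolding 4 by (simp add: ac_simps)
  also have "\<dots> \<le> (\<integral>\<^sup>+x. W n x \<partial>M) + (\<Sum>j\<in>{n..<m}. \<integral>\<^sup>+x. \<beta> j x \<partial>M) + (\<integral>\<^sup>+x. \<beta> m x \<partial>M)"
    by (intro add_right_mono step.IH)
  also have "\<dots> = (\<integral>\<^sup>+x. W n x \<partial>M) + (\<Sum>j\<in>{n..<Suc m}. \<integral>\<^sup>+x. \<beta> j x \<partial>M)"
    using step.hyps by (simp add: ac_simps)
  finally show ?case .
qed

text \<open>The finite-horizon bound is used without the integral over the surviving paths, and the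
  horizon tends to infinity by continuity from below.\<close>

lemma maximal_inequality:
  "c * emeasure M {x \<in> space M. \<exists>j\<ge>n. c \<le> W j x}
    \<le> (\<integral>\<^sup>+x. W n x \<partial>M) + (\<Sum>j. \<integral>\<^sup>+x. \<beta> (j + n) x \<partial>M)"
proof -
  let ?B = "\<lambda>m. {x \<in> space M. \<forall>j\<in>{n..<n+m}. W j x < c}"
  have meas: "?B m \<in> sets M" for m
    by (rule sets_F_M[OF sets_below[of "n+m" "n+m"]]) simp
  have "{x \<in> space M. \<exists>j\<ge>n. c \<le> W j x} = (\<Union>m. space M - ?B m)"
  proof (intro equalityI subsetI)
    fix x assume "x \<in> {x \<in> space M. \<exists>j\<ge>n. c \<le> W j x}"
    then obtain j where "x \<in> space M" "n \<le> j" "c \<le> W j x" by auto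
    \<comment> \<open>The horizon becomes \<open>n + (Suc j - n) = Suc j\<close>, the first one
      whose interval contains \<open>j\<close>.\<close>
    then have "x \<in> space M - ?B (Suc j - n)" by (auto simp: not_less intro!: bexI[of _ j])
    then show "x \<in> (\<Union>m. space M - ?B m)" by blast
  qed (auto simp: not_less)
  then have "c * emeasure M {x \<in> space M. \<exists>j\<ge>n. c \<le> W j x}
      = c * (SUP m. emeasure M (space M - ?B m))"
    using meas by (subst SUP_emeasure_incseq) (auto simp: incseq_def)
  also have "\<dots> = (SUP m. c * emeasure M (space M - ?B m))"
    by (rule SUP_mult_left_ennreal)
  also have "\<dots> \<le> (\<integral>\<^sup>+x. W n x \<partial>M) + (\<Sum>j. \<integral>\<^sup>+x. \<beta> (j + n) x \<partial>M)"
  proof (rule SUP_least)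
    fix m
    have "c * emeasure M (space M - ?B m)
        \<le> c * emeasure M (space M - ?B m) + (\<integral>\<^sup>+x\<in>?B m. W (n+m) x \<partial>M)"
      by simp
    also have "\<dots> \<le> (\<integral>\<^sup>+x. W n x \<partial>M) + (\<Sum>j\<in>{n..<n+m}. \<integral>\<^sup>+x. \<beta> j x \<partial>M)"
      using maximal_step[of n "n+m" c] by simp
    also have "(\<Sum>j\<in>{n..<n+m}. \<integral>\<^sup>+x. \<beta> j x \<partial>M) = (\<Sum>j<m. \<integral>\<^sup>+x. \<beta> (j+n) x \<partial>M)"
      using sum.shift_bounds_nat_ivl[of "\<lambda>j. \<integral>\<^sup>+x. \<beta> j x \<partial>M" 0 n m]
      by (simp add: atLeast0LessThan add.commute)
    also have "\<dots> \<le> (\<Sum>j. \<integral>\<^sup>+x. \<beta> (j+n) x \<partial>M)"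
      by (rule sum_le_suminf) auto
    finally show "c * emeasure M (space M - ?B m)
        \<le> (\<integral>\<^sup>+x. W n x \<partial>M) + (\<Sum>j. \<integral>\<^sup>+x. \<beta> (j + n) x \<partial>M)"
      by (simp add: add_left_mono)
  qed
  finally show ?thesis .
qed

section \<open>Expectations along the sequence\<close>

text \<open>Telescoping of \<open>drift\<close> over the whole space, keeping the losses
  \<open>a k\<close> times the expectation of \<open>W k\<close>. Each loss is added to the left
  side instead of being subtracted on the right, since subtraction in \<open>ennreal\<close> is
  truncated.\<close>

lemma weighted_expectation_bound:
  "(\<integral>\<^sup>+x. W m x \<partial>M) + (\<Sum>k<m. ennreal (a k) * (\<integral>\<^sup>+x. W k x \<partial>M))
    \<le> (\<integral>\<^sup>+x. W 0 x \<partial>M) + (\<Sum>k<m. \<integral>\<^sup>+x. \<beta> k x \<partial>M)"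
proof (induction m)
  case (Suc m)
  let ?e = "\<lambda>k. \<integral>\<^sup>+x. W k x \<partial>M" and ?s = "\<lambda>k. \<integral>\<^sup>+x. \<beta> k x \<partial>M"
  have "?e (Suc m) = (\<integral>\<^sup>+x\<in>space M. W (Suc m) x \<partial>M)"
    by (intro nn_integral_cong) auto
  also have "\<dots> \<le> (\<integral>\<^sup>+x\<in>space M. (ennreal (1 - a m) * W m x + \<beta> m x) \<partial>M)"
    using sets.top[of "F m"] by (intro drift) simp
  also have "\<dots> = (\<integral>\<^sup>+x. ennreal (1 - a m) * W m x + \<beta> m x \<partial>M)"
    by (intro nn_integral_cong) auto
  also have "\<dots> = ennreal (1 - a m) * ?e m + ?s m"
    by (simp add: nn_integral_add nn_integral_cmult)
  finally have "?e (Suc m) + ennreal (a m) * ?e m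
      \<le> ennreal (1 - a m) * ?e m + ?s m + ennreal (a m) * ?e m"
    by (rule add_right_mono)
  also have "\<dots> = (ennreal (1 - a m) + ennreal (a m)) * ?e m + ?s m"
    by (simp only: distrib_right add.assoc add.commute add.left_commute)
  also have "ennreal (1 - a m) + ennreal (a m) = 1"
    using a_bounds[of m] by (simp flip: ennreal_plus)
  finally have "?e (Suc m) + ennreal (a m) * ?e m \<le> ?e m + ?s m" by simp
  then have "?e (Suc m) + ennreal (a m) * ?e m + (\<Sum>k<m. ennreal (a k) * ?e k)
      \<le> ?e m + ?s m + (\<Sum>k<m. ennreal (a k) * ?e k)"
    by (rule add_right_mono)
  also have "\<dots> = ?e m + (\<Sum>k<m. ennreal (a k) * ?e k) + ?s m" by (simp add: ac_simps)
  also have "\<dots> \<le> ?e 0 + (\<Sum>k<m. ?s k) + ?s m"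
    by (intro add_right_mono Suc.IH)
  finally show ?case by (simp add: ac_simps)
qed simp

text \<open>If all expectations from \<open>m\<close> on exceeded \<delta>, the weighted sum would
  dominate \<delta> times a tail of the divergent series of \<open>a\<close>, yet it is bounded by a
  finite constant.\<close>

lemma expectation_frequently_small:
  assumes div: "filterlim (\<lambda>n. \<Sum>k<n. a k) at_top sequentially"
    and W0: "(\<integral>\<^sup>+x. W 0 x \<partial>M) < \<infinity>"
    and \<beta>: "(\<Sum>k. \<integral>\<^sup>+x. \<beta> k x \<partial>M) < \<infinity>"
    and "0 < \<delta>"
  shows "\<exists>n\<ge>m. (\<integral>\<^sup>+x. W n x \<partial>M) \<le> ennreal \<delta>"
proof (rule ccontr)
  let ?e = "\<lambda>k. \<integral>\<^sup>+x. W k x \<partial>M"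
  assume "\<not> ?thesis"
  then have large: "ennreal \<delta> \<le> ?e n" if "m \<le> n" for n
    using that by (meson linear)
  obtain C where C: "0 \<le> C" "?e 0 + (\<Sum>k. \<integral>\<^sup>+x. \<beta> k x \<partial>M) = ennreal C"
    using W0 \<beta> by (cases "?e 0 + (\<Sum>k. \<integral>\<^sup>+x. \<beta> k x \<partial>M)") auto
  have bound: "\<delta> * (\<Sum>k\<in>{m..<n}. a k) \<le> C" for n
  proof -
    have "ennreal (\<delta> * (\<Sum>k\<in>{m..<n}. a k)) = (\<Sum>k\<in>{m..<n}. ennreal (a k) * ennreal \<delta>)"
      using a_bounds \<open>0 < \<delta>\<close>
      by (simp add: sum_distrib_left sum_ennreal mult.commute flip: ennreal_mult)
    also have "\<dots> \<le> (\<Sum>k\<in>{m..<n}. ennreal (a k) * ?e k)"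
      using large by (intro sum_mono mult_left_mono) auto
    also have "\<dots> \<le> (\<Sum>k<n. ennreal (a k) * ?e k)"
      by (intro sum_mono2) auto
    also have "\<dots> \<le> ?e n + (\<Sum>k<n. ennreal (a k) * ?e k)"
      by simp
    also have "\<dots> \<le> ?e 0 + (\<Sum>k<n. \<integral>\<^sup>+x. \<beta> k x \<partial>M)"
      by (rule weighted_expectation_bound)
    also have "\<dots> \<le> ennreal C"
      unfolding C(2)[symmetric] by (intro add_left_mono sum_le_suminf) auto
    finally show ?thesis using C(1) by (simp add: ennreal_le_iff)
  qed
  \<comment> \<open>After the first \<open>m\<close> terms are removed, this threshold leaves a sum
    over \<open>{m..<n}\<close> of at least \<open>C / \<delta> + 1\<close>, contradicting
    \<open>bound\<close>.\<close>
  have "eventually (\<lambda>n. C / \<delta> + (\<Sum>k<m. a k) + 1 \<le> (\<Sum>k<n. a k)) sequentially"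
    using div by (simp add: filterlim_at_top)
  then have "eventually (\<lambda>n. m \<le> n \<and> C / \<delta> + (\<Sum>k<m. a k) + 1 \<le> (\<Sum>k<n. a k)) sequentially"
    using eventually_ge_at_top[of m] by eventually_elim simp
  then obtain n where n: "m \<le> n" "C / \<delta> + (\<Sum>k<m. a k) + 1 \<le> (\<Sum>k<n. a k)"
    by (auto simp: eventually_sequentially)
  have "(\<Sum>k<m. a k) + (\<Sum>k\<in>{m..<n}. a k) = (\<Sum>k<n. a k)"
    using n(1) by (simp add: sum.atLeastLessThan_concat flip: atLeast0LessThan)
  then have "C / \<delta> < (\<Sum>k\<in>{m..<n}. a k)" using n(2) by simp
  then show False using bound[of n] \<open>0 < \<delta>\<close> by (simp add: field_simps)
qed

section \<open>Almost sure convergence\<close>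

text \<open>Reaching a level \<open>c > 0\<close> infinitely often implies an excursion after every
  time \<open>n\<close>. For suitable \<open>n\<close> both terms of the maximal inequality are at
  most \<delta>/2, so this event is null.\<close>

lemma AE_tendsto_zero_if_finite_expectation:
  assumes div: "filterlim (\<lambda>n. \<Sum>k<n. a k) at_top sequentially"
    and W0: "(\<integral>\<^sup>+x. W 0 x \<partial>M) < \<infinity>"
    and \<beta>: "(\<Sum>k. \<integral>\<^sup>+x. \<beta> k x \<partial>M) < \<infinity>"
  shows "AE x in M. (\<lambda>k. W k x) \<longlonglongrightarrow> 0"
proof -
  have ev: "AE x in M. eventually (\<lambda>j. W j x < ennreal c) sequentially" if "0 < c" for c
  proof -
    let ?L = "{x \<in> space M. \<forall>n. \<exists>j\<ge>n. ennreal c \<le> W j x}"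
    \<comment> \<open>The summand \<open>0\<close> matches the shape expected by
      \<open>ennreal_le_epsilon\<close>.\<close>
    have "ennreal c * emeasure M ?L \<le> 0 + ennreal \<delta>" if "0 < \<delta>" for \<delta> :: real
    proof -
      obtain m where m: "\<And>n. m \<le> n \<Longrightarrow> (\<Sum>k. \<integral>\<^sup>+x. \<beta> (k + n) x \<partial>M) < ennreal (\<delta>/2)"
        using ennreal_suminf_exist_split[OF \<beta>, of "\<delta>/2"] \<open>0 < \<delta>\<close> by auto
      obtain n where n: "m \<le> n" "(\<integral>\<^sup>+x. W n x \<partial>M) \<le> ennreal (\<delta>/2)"
        using expectation_frequently_small[OF div W0 \<beta>, of "\<delta>/2" m] \<open>0 < \<delta>\<close> by auto
      have "ennreal c * emeasure M ?L
          \<le> ennreal c * emeasure M {x \<in> space M. \<exists>j\<ge>n. ennreal c \<le> W j x}"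
        by (intro mult_left_mono emeasure_mono) auto
      also have "\<dots> \<le> (\<integral>\<^sup>+x. W n x \<partial>M) + (\<Sum>j. \<integral>\<^sup>+x. \<beta> (j + n) x \<partial>M)"
        by (rule maximal_inequality)
      also have "\<dots> \<le> ennreal (\<delta>/2) + ennreal (\<delta>/2)"
        using n(2) less_imp_le[OF m[OF n(1)]] by (rule add_mono)
      also have "\<dots> = 0 + ennreal \<delta>"
        using \<open>0 < \<delta>\<close> by (simp flip: ennreal_plus)
      finally show ?thesis .
    qed
    then have "ennreal c * emeasure M ?L \<le> 0"
      by (rule ennreal_le_epsilon)
    then have "emeasure M ?L = 0"
      using \<open>0 < c\<close> by simp
    moreover have "?L \<in> sets M" by measurable
    ultimately have "AE x in M. x \<notin> ?L"
      by (intro AE_not_in) (auto simp: null_sets_def)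
    then show ?thesis
      using AE_space by eventually_elim (simp add: eventually_sequentially flip: not_le)
  qed
  \<comment> \<open>Countably many levels tending to zero suffice, so a single null set serves all
    of them.\<close>
  have "AE x in M. \<forall>q. eventually (\<lambda>j. W j x < ennreal (inverse (real (Suc q)))) sequentially"
    unfolding AE_all_countable by (intro allI ev) simp
  then show ?thesis
  proof eventually_elim
    case (elim x)
    show ?case
    proof (rule order_tendstoI)
      fix y :: ennreal assume "0 < y"
      then obtain r where r: "0 < ennreal r" "ennreal r < y"
        by (metis ennreal_cases dense ennreal_less_top top.not_eq_extremum order.strict_trans)
      then obtain q where "inverse (real (Suc q)) < r"
        using reals_Archimedean[of r] by auto
      then have "ennreal (inverse (real (Suc q))) < y"
        using r by (meson ennreal_leI less_imp_le le_less_trans)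
      with elim show "eventually (\<lambda>j. W j x < y) sequentially"
        by (auto elim!: eventually_mono[OF spec[of _ q]])
    qed simp
  qed
qed

text \<open>Localization: the process is set to zero once a budget \<open>N\<close> is exceeded,
  which makes all relevant expectations finite; almost every path stays within some budget
  forever.\<close>

lemma AE_tendsto_zero:
  assumes div: "filterlim (\<lambda>n. \<Sum>k<n. a k) at_top sequentially"
    and fin: "emeasure M (space M) < \<infinity>"
    and W0: "AE x in M. W 0 x < \<infinity>"
    and \<beta>: "AE x in M. (\<Sum>k. \<beta> k x) < \<infinity>"
  shows "AE x in M. (\<lambda>k. W k x) \<longlonglongrightarrow> 0"
proof -
  \<comment> \<open>The sum runs over \<open>l < k\<close>, so \<open>G N (Suc k)\<close> involves
    \<beta> only up to time \<open>k\<close> and lies in \<open>F k\<close>: the localization is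
    predictable.\<close>
  define G where "G = (\<lambda>(N::nat) k. {x \<in> space M. W 0 x \<le> of_nat N \<and> (\<Sum>l<k. \<beta> l x) \<le> of_nat N})"
  have G_sets: "G N k \<in> sets (F l)" if "k \<le> Suc l" for N k l
  proof -
    have [measurable]: "W 0 \<in> borel_measurable (F l)"
      by (rule adapted_mono[OF _ W_adapted]) simp
    have [measurable]: "\<beta> j \<in> borel_measurable (F l)" if "j \<in> {..<k}" for j
      using that \<open>k \<le> Suc l\<close> by (intro adapted_mono[OF _ \<beta>_adapted]) auto
    have "{x \<in> space (F l). W 0 x \<le> of_nat N \<and> (\<Sum>l<k. \<beta> l x) \<le> of_nat N} \<in> sets (F l)"
      by measurable
    then show ?thesis by (simp add: G_def)
  qed
  have G_M [measurable]: "G N k \<in> sets M" for N k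
    by (rule sets_F_M[OF G_sets[of k k]]) simp
  have G_anti: "G N (Suc k) \<subseteq> G N k" for N k
    by (auto simp: G_def intro: order_trans[OF add_increasing2[OF zero_le order_refl]])
  have conv: "AE x in M. (\<lambda>k. W k x * indicator (G N k) x) \<longlonglongrightarrow> 0" for N
  proof -
    \<comment> \<open>The shift to \<open>G N (Suc k)\<close> in \<open>?\<beta>\<close> includes
      \<open>\<beta> k\<close> itself in the budget, so no term can overshoot \<open>N\<close>. Both
      \<open>?\<beta> k\<close> and the localized \<open>?W (Suc k)\<close> carry the same
      indicator.\<close>
    let ?W = "\<lambda>k x. W k x * indicator (G N k) x" and ?\<beta> = "\<lambda>k x. \<beta> k x * indicator (G N (Suc k)) x"
    interpret stopped: almost_supermartingale M F ?W ?\<beta> a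
    proof
      fix k
      show "?W k \<in> borel_measurable (F k)" "?\<beta> k \<in> borel_measurable (F k)"
        using W_adapted[of k] \<beta>_adapted[of k] G_sets[of k k N] G_sets[of "Suc k" k N] by auto
      fix A assume A: "A \<in> sets (F k)"
      have "(\<integral>\<^sup>+x\<in>A. ?W (Suc k) x \<partial>M) = (\<integral>\<^sup>+x\<in>A \<inter> G N (Suc k). W (Suc k) x \<partial>M)"
        by (intro nn_integral_cong) (auto split: split_indicator)
      also have "\<dots> \<le> (\<integral>\<^sup>+x\<in>A \<inter> G N (Suc k). (ennreal (1 - a k) * W k x + \<beta> k x) \<partial>M)"
        using A G_sets[of "Suc k" k N] by (intro drift) auto
      also have "\<dots> \<le> (\<integral>\<^sup>+x\<in>A. (ennreal (1 - a k) * ?W k x + ?\<beta> k x) \<partial>M)"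
        using G_anti[of N k] by (intro nn_integral_mono) (auto split: split_indicator)
      finally show "(\<integral>\<^sup>+x\<in>A. ?W (Suc k) x \<partial>M) \<le> (\<integral>\<^sup>+x\<in>A. (ennreal (1 - a k) * ?W k x + ?\<beta> k x) \<partial>M)" .
    qed (use subalg filtration a_bounds in auto)
    have finN: "(\<integral>\<^sup>+x. of_nat N \<partial>M) < \<infinity>"
      using fin by (simp add: ennreal_mult_less_top of_nat_less_top)
    have "(\<integral>\<^sup>+x. ?W 0 x \<partial>M) \<le> (\<integral>\<^sup>+x. of_nat N \<partial>M)"
      by (intro nn_integral_mono) (auto simp: G_def split: split_indicator)
    then have 1: "(\<integral>\<^sup>+x. ?W 0 x \<partial>M) < \<infinity>"
      using finN by (rule le_less_trans)
    \<comment> \<open>Inside \<open>G N (Suc m)\<close> the unlocalized sum is already within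
      budget; outside it the newest term vanishes and the previous bound persists.\<close>
    have "(\<Sum>k<m. ?\<beta> k x) \<le> of_nat N" for m x
    proof (induction m)
      case (Suc m)
      show ?case
      proof (cases "x \<in> G N (Suc m)")
        case True
        have "(\<Sum>k<Suc m. ?\<beta> k x) \<le> (\<Sum>k<Suc m. \<beta> k x)"
          by (intro sum_mono) (auto split: split_indicator)
        also have "\<dots> \<le> of_nat N" using True by (simp add: G_def)
        finally show ?thesis .
      qed (use Suc in auto)
    qed simp
    then have sum_le: "(\<Sum>k. ?\<beta> k x) \<le> of_nat N" for x
      by (intro suminf_le_const) auto
    have "(\<Sum>k. \<integral>\<^sup>+x. ?\<beta> k x \<partial>M) = (\<integral>\<^sup>+x. (\<Sum>k. ?\<beta> k x) \<partial>M)"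
      by (intro nn_integral_suminf[symmetric]) auto
    also have "\<dots> \<le> (\<integral>\<^sup>+x. of_nat N \<partial>M)"
      by (intro nn_integral_mono sum_le)
    finally have 2: "(\<Sum>k. \<integral>\<^sup>+x. ?\<beta> k x \<partial>M) < \<infinity>"
      using finN by (rule le_less_trans)
    show ?thesis
      by (rule stopped.AE_tendsto_zero_if_finite_expectation[OF div 1 2])
  qed
  then have "AE x in M. \<forall>N. (\<lambda>k. W k x * indicator (G N k) x) \<longlonglongrightarrow> 0"
    by (simp add: AE_all_countable)
  with W0 \<beta> AE_space show ?thesis
  proof eventually_elim
    case (elim x)
    have "max (W 0 x) (\<Sum>k. \<beta> k x) < \<infinity>" using elim by simp
    then obtain N :: nat where N: "max (W 0 x) (\<Sum>k. \<beta> k x) < of_nat N"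
      using ennreal_Ex_less_of_nat[of "max (W 0 x) (\<Sum>k. \<beta> k x)"] by (auto simp del: max_less_iff_conj)
    have "x \<in> G N k" for k
    proof -
      have "(\<Sum>l<k. \<beta> l x) \<le> (\<Sum>l. \<beta> l x)" by (rule sum_le_suminf) auto
      with N elim show ?thesis by (auto simp: G_def)
    qed
    moreover have "(\<lambda>k. W k x * indicator (G N k) x) \<longlonglongrightarrow> 0" using elim by blast
    ultimately show ?case by simp
  qed
qed

end

section \<open>The filtration generated by the data\<close>

lemma space_history [simp]: "space (history M v b k) = space M"
  by (simp add: history_def space_measure_of_conv)

lemma sets_history:
  "sets (history M v b k) = sigma_sets (space M)
     ({v l -` A \<inter> space M | l A. l \<le> k \<and> A \<in> sets borel} \<union>
      {b l -` B \<inter> space M | l B. l \<le> k \<and> B \<in> sets borel})"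
  unfolding history_def by (rule sets_measure_of) auto

lemma sets_history_mono: "k \<le> l \<Longrightarrow> sets (history M v b k) \<subseteq> sets (history M v b l)"
  unfolding sets_history by (intro sigma_sets_mono' Un_mono) (blast intro: le_trans)+

lemma history_measurable_fst: "v k \<in> borel_measurable (history M v b k)"
  by (rule measurableI) (auto simp: sets_history intro!: sigma_sets.Basic)

lemma history_measurable_snd: "b k \<in> borel_measurable (history M v b k)"
  by (rule measurableI) (auto simp: sets_history intro!: sigma_sets.Basic UnI2)

section \<open>Reduction of vectors to scalars by weighting with \<pi>\<close>

text \<open>Moving the matrix onto \<pi> by transposition turns the hypothesis on
  \<open>\<pi> v* V\<close> into a scalar contraction; nonnegativity of \<open>x\<close> preserves
  the entrywise inequality under the inner product.\<close>

lemma drift_real: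
  fixes V :: "real ^ 'd ^ 'd" and \<pi> x :: "real ^ 'd"
  assumes "\<And>i. 0 \<le> x $ i" and "\<And>i. (\<pi> v* V) $ i \<le> (r *\<^sub>R \<pi>) $ i"
  shows "\<pi> \<bullet> (V *v x + c *\<^sub>R 1) \<le> r * (\<pi> \<bullet> x) + (\<pi> \<bullet> 1) * c"
proof -
  have "\<pi> \<bullet> (V *v x) = (\<pi> v* V) \<bullet> x"
    by (simp add: dot_lmul_matrix)
  also have "\<dots> \<le> (r *\<^sub>R \<pi>) \<bullet> x"
    unfolding inner_vec_def using assms by (intro sum_mono) (simp add: mult_right_mono)
  finally show ?thesis by (simp add: inner_add_right)
qed

text \<open>Lets nonnegative integrals and conditional expectations be handled entry by entry.
  Nonnegativity matters because \<open>ennreal\<close> sends negative reals to zero.\<close>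

lemma ennreal_inner_vec:
  fixes x y :: "real ^ 'd"
  assumes "\<And>i. 0 \<le> x $ i" and "\<And>i. 0 \<le> y $ i"
  shows "ennreal (x \<bullet> y) = (\<Sum>i\<in>UNIV. ennreal (x $ i) * ennreal (y $ i))"
  using assms by (simp add: inner_vec_def sum_ennreal flip: ennreal_mult)

text \<open>Each entry satisfies \<open>\<pi> $ i * x k $ i \<le> \<pi> \<bullet> x k\<close>, as
  the other summands are nonnegative; dividing by the positive weight gives a sandwich.\<close>

lemma tendsto_zero_if_inner_tendsto_zero:
  fixes \<pi> :: "real ^ 'd" and x :: "nat \<Rightarrow> real ^ 'd"
  assumes \<pi>: "\<And>i. 0 < \<pi> $ i" and x: "\<And>k i. 0 \<le> x k $ i"
    and lim: "(\<lambda>k. \<pi> \<bullet> x k) \<longlonglongrightarrow> 0"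
  shows "x \<longlonglongrightarrow> 0"
proof (rule vec_tendstoI)
  fix i
  have "(\<lambda>k. x k $ i) \<longlonglongrightarrow> 0"
  proof (rule tendsto_sandwich[OF _ _ tendsto_const])
    show "(\<lambda>k. (\<pi> \<bullet> x k) / \<pi> $ i) \<longlonglongrightarrow> 0"
      using tendsto_divide_zero[OF lim] .
    have "\<pi> $ i * x k $ i \<le> \<pi> \<bullet> x k" for k
      unfolding inner_vec_def inner_real_def
      using \<pi> x by (intro member_le_sum) (auto intro!: mult_nonneg_nonneg intro: less_imp_le)
    then show "\<forall>\<^sub>F k in sequentially. x k $ i \<le> (\<pi> \<bullet> x k) / \<pi> $ i"
      using \<pi>[of i] by (intro always_eventually) (simp add: field_simps)
  qed (use x in simp)
  then show "(\<lambda>k. x k $ i) \<longlonglongrightarrow> 0 $ i" by simp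
qed

section \<open>Convergence of the vector sequence\<close>

theorem lemma8:
  fixes M :: "'a measure"
    and v :: "nat \<Rightarrow> 'a \<Rightarrow> real ^ 'd"
    and b :: "nat \<Rightarrow> 'a \<Rightarrow> real"
    and V :: "nat \<Rightarrow> real ^ 'd ^ 'd"
    and \<pi> :: "real ^ 'd"
    and a :: "nat \<Rightarrow> real"
  assumes "prob_space M"
    and "\<And>k. v k \<in> borel_measurable M"
    and "\<And>k. b k \<in> borel_measurable M"
    and "\<And>k. AE \<omega> in M. \<forall>i. 0 \<le> v k \<omega> $ i"
    and "\<And>k. AE \<omega> in M. 0 \<le> b k \<omega>"
    and "AE \<omega> in M. summable (\<lambda>k. b k \<omega>)"
    and "\<And>k i j. 0 \<le> V k $ i $ j"
    and "\<And>k. AE \<omega> in M. \<forall>i.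
           nn_cond_exp M (history M v b k) (\<lambda>\<omega>'. ennreal (v (Suc k) \<omega>' $ i)) \<omega>
             \<le> ennreal ((V k *v v k \<omega> + b k \<omega> *\<^sub>R 1) $ i)"
    and "\<And>i. 0 < \<pi> $ i"
    and "\<And>k. 0 < a k \<and> a k < 1"
    and "filterlim (\<lambda>n. \<Sum>k<n. a k) at_top sequentially"
    and "\<And>k i. (\<pi> v* V k) $ i \<le> ((1 - a k) *\<^sub>R \<pi>) $ i"
  shows "AE \<omega> in M. (\<lambda>k. v k \<omega>) \<longlonglongrightarrow> 0"
proof -
  interpret prob_space M by fact
  note v_meas [measurable] = assms(2) and b_meas [measurable] = assms(3)
  let ?F = "history M v b"
  let ?W = "\<lambda>k x. ennreal (\<pi> \<bullet> v k x)" and ?\<beta> = "\<lambda>k x. ennreal ((\<pi> \<bullet> 1) * b k x)"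
  have history_subalg: "subalgebra M (?F k)" for k
    by (rule subalgebra_history[OF assms(2,3)])
  have v_nth [measurable]: "(\<lambda>x. v k x $ i) \<in> borel_measurable M" for k i
    by (rule borel_measurable_continuous_on[OF _ v_meas]) (intro continuous_intros)
  have \<pi>0: "0 \<le> \<pi> $ i" for i using assms(9)[of i] by simp
  have \<pi>1: "0 \<le> \<pi> \<bullet> 1" using \<pi>0 by (auto simp: inner_vec_def intro: sum_nonneg)
  interpret almost_supermartingale M ?F ?W ?\<beta> a
  proof
    fix k
    show "?W k \<in> borel_measurable (?F k)"
      by (intro measurable_compose[OF _ measurable_ennreal] borel_measurable_inner
          borel_measurable_const history_measurable_fst)
    show "?\<beta> k \<in> borel_measurable (?F k)"
      by (intro measurable_compose[OF _ measurable_ennreal] borel_measurable_times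
          borel_measurable_const history_measurable_snd)
    interpret finite_measure_subalgebra M "?F k"
      by unfold_locales (rule history_subalg)
    let ?E = "\<lambda>i. nn_cond_exp M (?F k) (\<lambda>x. ennreal (v (Suc k) x $ i))"
    have r: "0 \<le> 1 - a k" using assms(10)[of k] by simp
    fix A assume A: "A \<in> sets (?F k)"
    then have A_M [measurable]: "A \<in> sets M"
      using history_subalg[of k] by (auto simp: subalgebra_def)
    have E_meas [measurable]: "?E i \<in> borel_measurable M" for i by simp
    \<comment> \<open>The defining property of conditional expectation on an event of the history;
      it replaces the next value of each entry by its conditional expectation.\<close>
    have cond: "(\<integral>\<^sup>+x. indicator A x * ennreal (v (Suc k) x $ i) \<partial>M)
        = (\<integral>\<^sup>+x. indicator A x * ?E i x \<partial>M)" for i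
      using A by (intro nn_cond_exp_intg[symmetric]) auto
    \<comment> \<open>The entries of \<open>v\<close> are nonnegative only almost surely, so the
      expansion into entries is an identity of integrands almost everywhere.\<close>
    have "(\<integral>\<^sup>+x\<in>A. ?W (Suc k) x \<partial>M)
        = (\<integral>\<^sup>+x. (\<Sum>i\<in>UNIV. ennreal (\<pi> $ i) * (indicator A x * ennreal (v (Suc k) x $ i))) \<partial>M)"
      using assms(4)[of "Suc k"]
      by (intro nn_integral_cong_AE, eventually_elim)
        (auto simp: ennreal_inner_vec \<pi>0 split: split_indicator)
    also have "\<dots> = (\<Sum>i\<in>UNIV. ennreal (\<pi> $ i) * (\<integral>\<^sup>+x. indicator A x * ?E i x \<partial>M))"
      by (simp add: nn_integral_sum nn_integral_cmult cond)
    also have "\<dots> = (\<integral>\<^sup>+x. (\<Sum>i\<in>UNIV. ennreal (\<pi> $ i) * (indicator A x * ?E i x)) \<partial>M)"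
      by (simp add: nn_integral_sum nn_integral_cmult)
    also have "\<dots> \<le> (\<integral>\<^sup>+x\<in>A. (ennreal (1 - a k) * ?W k x + ?\<beta> k x) \<partial>M)"
      using assms(4)[of k] assms(5)[of k] assms(8)[of k]
    proof (intro nn_integral_mono_AE, eventually_elim)
      case (elim x)
      let ?y = "V k *v v k x + b k x *\<^sub>R 1"
      have y: "0 \<le> ?y $ i" for i
        using elim assms(7) by (auto simp: matrix_vector_mult_def intro!: sum_nonneg add_nonneg_nonneg)
      have "(\<Sum>i\<in>UNIV. ennreal (\<pi> $ i) * ?E i x) \<le> (\<Sum>i\<in>UNIV. ennreal (\<pi> $ i) * ennreal (?y $ i))"
        using elim by (intro sum_mono mult_left_mono) auto
      also have "\<dots> = ennreal (\<pi> \<bullet> ?y)"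
        using y \<pi>0 by (simp only: ennreal_inner_vec)
      also have "\<dots> \<le> ennreal ((1 - a k) * (\<pi> \<bullet> v k x) + (\<pi> \<bullet> 1) * b k x)"
        using elim assms(12) by (intro ennreal_leI drift_real) auto
      also have "\<dots> = ennreal (1 - a k) * ?W k x + ?\<beta> k x"
      proof -
        have "0 \<le> \<pi> \<bullet> v k x"
          using elim \<pi>0 by (auto simp: inner_vec_def intro: sum_nonneg)
        then show ?thesis
          using r \<pi>1 elim by (simp add: ennreal_plus ennreal_mult)
      qed
      finally show ?case by (auto split: split_indicator)
    qed
    finally show "(\<integral>\<^sup>+x\<in>A. ?W (Suc k) x \<partial>M)
        \<le> (\<integral>\<^sup>+x\<in>A. (ennreal (1 - a k) * ?W k x + ?\<beta> k x) \<partial>M)" .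
  qed (use history_subalg assms(10) in \<open>auto intro: less_imp_le sets_history_mono[THEN subsetD]\<close>)
  have b0: "AE x in M. \<forall>k. 0 \<le> b k x" and v0: "AE x in M. \<forall>k i. 0 \<le> v k x $ i"
    using assms(4,5) by (simp_all add: AE_all_countable)
  have "AE x in M. (\<Sum>k. ?\<beta> k x) < \<infinity>"
    using assms(6) b0
  proof eventually_elim
    case (elim x)
    then have "(\<Sum>k. ?\<beta> k x) = ennreal (\<Sum>k. (\<pi> \<bullet> 1) * b k x)"
      using \<pi>1 by (intro suminf_ennreal2 summable_mult) auto
    then show ?case by simp
  qed
  then have "AE x in M. (\<lambda>k. ?W k x) \<longlonglongrightarrow> 0"
    using assms(11) emeasure_space_1 by (intro AE_tendsto_zero) auto
  then show ?thesis
    using v0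
  proof eventually_elim
    case (elim x)
    \<comment> \<open>Convergence in \<open>ennreal\<close> returns to the reals because no value
      was truncated on this path.\<close>
    have "0 \<le> \<pi> \<bullet> v k x" for k
      using elim \<pi>0 by (auto simp: inner_vec_def intro: sum_nonneg)
    then have "(\<lambda>k. \<pi> \<bullet> v k x) \<longlonglongrightarrow> 0"
      using elim(1) by (simp add: tendsto_ennreal_iff flip: ennreal_0)
    then show ?case
      using elim(2) assms(9) by (intro tendsto_zero_if_inner_tendsto_zero[of \<pi>]) auto
  qed
qed

end
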